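(* Let $V=\mathbb{C}^4$ and let $Z\subset\bigwedge^2 V$ be a nonzero linear subspace such that $\mathbb{P}Z\subset\mathbb{P}\bigwedge^2V$ is disjoint from the Grassmannian $\mathrm{Gr}_2 V$. Then $Z$ is self-adjoint.
   Context: $\mathbb{P}W$ denotes the projective space of one-dimensional linear subspaces of a vector space $W$. $\mathrm{Gr}_2V$ is the Grassmannian of 2-dimensional subspaces of $V$, embedded in $\mathbb{P}\bigwedge^2V$ by the Plücker embedding (a subspace with basis $v_1,v_2$ goes to the span of $v_1\wedge v_2$). For an even-dimensional complex vector space $V$ and $1<m<\dim V$, a linear subspace $Z\subset\bigwedge^mV$ is self-adjoint if there exists a symplectic form $\sigma$ on $V^*$, i.e. an element $\sigma\in\bigwedge^2V$ of full rank $\dim V$ (nondegenerate), such that $Z\supseteq\mathbb{C}\sigma\wedge\bigwedge^{m-2}V$. In the case $m=2$ the condition is that $\sigma\in Z$. *)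

theory Defs
  imports "HOL-Analysis.Analysis" "HOL-Library.Function_Algebras"
begin

text \<open>
  A tensor of degree m over \<open>V = complex ^ 'n\<close> is given by its components in the standard basis:
  a function on index lists that vanishes outside the lists of length m.  The exterior power of
  degree m is realised as the space of skew-symmetric tensors of degree m, equivalently as the
  space of alternating m-linear forms on the dual of V.
\<close>

type_synonym 'n tensor = "'n list \<Rightarrow> complex"

definition tscale :: "complex \<Rightarrow> 'n tensor \<Rightarrow> 'n tensor" where
  "tscale c a = (\<lambda>xs. c * a xs)"

interpretation tensor: vector_space tscale
  by unfold_locales (auto simp: tscale_def fun_eq_iff algebra_simps)

text \<open>Sign change under transpositions also forces components with a repeated index to vanish.\<close>

definition ext_power :: "nat \<Rightarrow> 'n::finite tensor set" where
  "ext_power m = {a.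
     (\<forall>xs. length xs \<noteq> m \<longrightarrow> a xs = 0) \<and>
     (\<forall>xs i j. i < length xs \<and> j < length xs \<and> i \<noteq> j \<longrightarrow>
        a (xs[i := xs ! j, j := xs ! i]) = - a xs)}"

definition vec_tensor :: "complex ^ 'n \<Rightarrow> 'n::finite tensor" where
  "vec_tensor v = (\<lambda>xs. case xs of [i] \<Rightarrow> v $ i | _ \<Rightarrow> 0)"

text \<open>
  The exterior product as a sum over shuffles: S is the set of positions passed to the first
  factor, and the exponent counts the inversions of the shuffle.  No restriction on the size
  of S is needed, because homogeneous tensors vanish on lists of the wrong length.  With this
  normalisation, the component of \<open>v \<wedge> w\<close> at \<open>[i, j]\<close> is \<open>v\<^sub>i w\<^sub>j - v\<^sub>j w\<^sub>i\<close>.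
\<close>

definition wedge :: "'n tensor \<Rightarrow> 'n tensor \<Rightarrow> 'n tensor" where
  "wedge a b = (\<lambda>xs. \<Sum>S\<in>Pow {..<length xs}.
     (-1) ^ card {(i, j). i \<in> S \<and> j \<in> {..<length xs} - S \<and> j < i}
       * a (nths xs S) * b (nths xs (- S)))"

definition proj_space :: "'n tensor set \<Rightarrow> 'n tensor set set" where
  "proj_space W = {L. tensor.subspace L \<and> tensor.dim L = 1 \<and> L \<subseteq> W}"

definition Gr2 :: "(complex ^ 'n) set set" where
  "Gr2 = {U. vec.subspace U \<and> vec.dim U = 2}"

text \<open>The Pluecker embedding as a relation, so that no basis has to be chosen.\<close>

definition pluecker :: "(complex ^ 'n) set \<Rightarrow> 'n::finite tensor set \<Rightarrow> bool" where
  "pluecker U L \<longleftrightarrow> (\<exists>v w. v \<noteq> w \<and> vec.independent {v, w} \<and> vec.span {v, w} = U \<and>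
     L = tensor.span {wedge (vec_tensor v) (vec_tensor w)})"

definition Gr2_pluecker :: "'n::finite tensor set set" where
  "Gr2_pluecker = {L. \<exists>U\<in>Gr2. pluecker U L}"

definition tensor_rank2 :: "'n::finite tensor \<Rightarrow> nat" where
  "tensor_rank2 s = rank ((\<chi> i j. s [i, j]) :: complex ^ 'n ^ 'n)"

text \<open>Intended for linear subspaces \<open>Z\<close> of \<open>ext_power m\<close>, with \<open>1 < m < CARD('n)\<close> and \<open>CARD('n)\<close> even.\<close>

definition self_adjoint :: "nat \<Rightarrow> 'n::finite tensor set \<Rightarrow> bool" where
  "self_adjoint m Z \<longleftrightarrow> (\<exists>s\<in>ext_power 2. tensor_rank2 s = CARD('n) \<and>
     {wedge (tscale c s) t | c t. t \<in> ext_power (m - 2)} \<subseteq> Z)"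

end

theory Submission
  imports Defs
begin

text \<open>
  Self-adjointness in degree two only asks for one element of \<open>Z\<close> of full rank, and in fact
  every nonzero \<open>s \<in> Z\<close> has full rank.  Suppose that the skew matrix of \<open>s\<close> has a nonzero
  kernel vector \<open>x\<close>.  Contracting \<open>s \<wedge> s\<close> with \<open>x\<close> gives \<open>2 (\<iota>\<^sub>x s) \<wedge> s = 0\<close>; in dimension four
  \<open>s \<wedge> s\<close> is a top-degree form, so it vanishes as soon as its contraction with one nonzero vector
  does.  In components, \<open>s\<close> satisfies the Pluecker relations
  (\<open>degenerate_imp_pluecker_relation\<close>).  The Pluecker relations in turn make \<open>s\<close> decomposable:
  if the component of \<open>s\<close> at \<open>[i, j]\<close> is nonzero, the \<open>i\<close>-th and \<open>j\<close>-th rows of \<open>s\<close> span a plane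
  whose Pluecker point is the line through \<open>s\<close> (\<open>pluecker_relations_imp_decomposable\<close>).
  That line would be a point of \<open>\<P>Z\<close> on the Grassmannian, which is excluded.
\<close>

section \<open>Exterior products in low degree\<close>

lemma vec_tensor_eq_0: "length xs \<noteq> 1 \<Longrightarrow> vec_tensor v xs = 0"
  by (auto simp: vec_tensor_def split: list.split)

lemma wedge_vec_tensor_pair:
  "wedge (vec_tensor v) (vec_tensor w) [k, l] = v $ k * w $ l - v $ l * w $ k"
proof -
  have pow: "Pow {..<Suc (Suc 0)} = {{}, {0}, {1}, {0, 1}}"
    by (simp add: lessThan_Suc Pow_insert) auto
  have inv0: "{(i, j). i = 0 \<and> j < Suc (Suc 0) \<and> 0 < j \<and> j < i} = ({} :: (nat \<times> nat) set)"
    by auto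
  have inv1: "{(i, j). i = Suc 0 \<and> j < Suc (Suc 0) \<and> j \<noteq> Suc 0 \<and> j < i} = {(Suc 0, 0)}"
    by auto
  show ?thesis
    unfolding wedge_def
    by (simp add: pow inv0 inv1 nths_Cons vec_tensor_def)
qed

lemma wedge_vec_tensor_eq_0:
  assumes "length xs \<noteq> 2"
  shows "wedge (vec_tensor v) (vec_tensor w) xs = 0"
proof -
  have "vec_tensor v (nths xs S) * vec_tensor w (nths xs (- S)) = 0" for S
  proof -
    have "card ({i. i < length xs \<and> i \<in> S} \<union> {i. i < length xs \<and> i \<in> - S})
        = length (nths xs S) + length (nths xs (- S))"
      unfolding length_nths by (rule card_Un_disjoint) auto
    moreover have "{i. i < length xs \<and> i \<in> S} \<union> {i. i < length xs \<and> i \<in> - S} = {..<length xs}"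
      by auto
    ultimately have "length (nths xs S) \<noteq> 1 \<or> length (nths xs (- S)) \<noteq> 1"
      using assms by auto
    then show ?thesis
      using vec_tensor_eq_0 by auto
  qed
  then show ?thesis
    unfolding wedge_def by (auto intro!: sum.neutral simp: mult.assoc)
qed

text \<open>
  A degree-zero tensor is a scalar: only the shuffle that sends every position to the first
  factor survives, and it has no inversions.
\<close>

lemma wedge_ext_power_0:
  assumes "t \<in> ext_power 0"
  shows "wedge a t = tscale (t []) a"
proof
  fix xs
  have "(-1) ^ card {(i, j). i \<in> S \<and> j \<in> {..<length xs} - S \<and> j < i}
          * a (nths xs S) * t (nths xs (- S))
      = (if S = {..<length xs} then a xs * t [] else 0)" if "S \<in> Pow {..<length xs}" for S
  proof (cases "S = {..<length xs}")
    case True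
    have "nths xs (- {..<length xs}) = []"
      by (simp flip: length_0_conv add: length_nths)
    with True show ?thesis by simp
  next
    case False
    with that obtain p where "p < length xs" "p \<notin> S" by auto
    then have "xs ! p \<in> set (nths xs (- S))"
      by (auto simp: set_nths)
    then have "length (nths xs (- S)) \<noteq> 0"
      by auto
    then have "t (nths xs (- S)) = 0"
      using assms unfolding ext_power_def by blast
    with False show ?thesis by simp
  qed
  then have "wedge a t xs = (\<Sum>S\<in>Pow {..<length xs}. if S = {..<length xs} then a xs * t [] else 0)"
    unfolding wedge_def by (intro sum.cong refl) auto
  then show "wedge a t xs = tscale (t []) a xs"
    by (simp add: tscale_def mult.commute)
qed

lemma ext_power_2_skew:
  assumes "s \<in> ext_power 2"
  shows "s [l, k] = - s [k, l]"
proof -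
  have "s (xs[i := xs ! j, j := xs ! i]) = - s xs"
    if "i < length xs" "j < length xs" "i \<noteq> j" for xs i j
    using assms that unfolding ext_power_def by blast
  from this[of 0 "[k, l]" 1] show ?thesis by simp
qed

lemma ext_power_2_eqI:
  assumes "s \<in> ext_power 2" "\<And>xs. length xs \<noteq> 2 \<Longrightarrow> t xs = 0" "\<And>k l. s [k, l] = t [k, l]"
  shows "s = t"
proof
  fix xs :: "'a list"
  show "s xs = t xs"
  proof (cases "length xs = 2")
    case True
    then obtain k l where "xs = [k, l]"
      by (auto simp: numeral_2_eq_2 length_Suc_conv)
    with assms show ?thesis by simp
  next
    case False
    with assms show ?thesis by (simp add: ext_power_def)
  qed
qed

section \<open>Degenerate forms and the Pluecker relations\<close>

lemma not_full_rank_imp_kernel: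
  fixes A :: "'a::field ^ 'n ^ 'm"
  assumes "rank A \<noteq> CARD('n)"
  obtains x where "x \<noteq> 0" "A *v x = 0"
proof -
  have "\<not> (\<forall>x. A *v x = 0 \<longrightarrow> x = 0)"
  proof
    assume "\<forall>x. A *v x = 0 \<longrightarrow> x = 0"
    then have "vec.span (rows A) = UNIV"
      by (simp flip: matrix_left_invertible_ker matrix_left_invertible_span_rows_gen)
    then have "vec.dim (rows A) = CARD('n)"
      by (metis vec.dim_span vec_dim_card)
    with assms show False
      by (simp add: row_rank_def_gen)
  qed
  with that show thesis by blast
qed

text \<open>
  The left-hand side is the component of \<open>\<onehalf> s \<wedge> s\<close> at \<open>[i, j, k, l]\<close>, up to sign the Pfaffian of
  \<open>s\<close> when the indices are distinct.  Rows \<open>i\<close>, \<open>j\<close>, \<open>k\<close> of the equation \<open>s x = 0\<close> show that its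
  product with \<open>x\<^sub>l\<close> vanishes.  As the expression is alternating in its indices, any index can be
  moved into the last place, in particular one with \<open>x\<^sub>l \<noteq> 0\<close>.
\<close>

lemma degenerate_imp_pluecker_relation:
  fixes s :: "'n::finite tensor"
  assumes card: "CARD('n) = 4"
    and s: "s \<in> ext_power 2"
    and rank: "tensor_rank2 s \<noteq> CARD('n)"
  shows "s [i, j] * s [k, l] - s [i, k] * s [j, l] + s [i, l] * s [j, k] = 0"
proof -
  note skew = ext_power_2_skew[OF s]
  have diag [simp]: "s [a, a] = 0" for a
    using skew[of a a] by simp
  define P where "P a b c d = s [a, b] * s [c, d] - s [a, c] * s [b, d] + s [a, d] * s [b, c]"
    for a b c d
  obtain x :: "complex ^ 'n" where x: "x \<noteq> 0" "(\<chi> i j. s [i, j]) *v x = 0"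
    using rank not_full_rank_imp_kernel unfolding tensor_rank2_def by blast
  have row: "(\<Sum>b\<in>UNIV. s [a, b] * x $ b) = 0" for a
    using arg_cong[OF x(2), of "\<lambda>y. y $ a"] by (simp add: matrix_vector_mult_def)
  have P_last: "P a b c d * x $ d = 0" if "distinct [a, b, c, d]" for a b c d
  proof -
    have "card {a, b, c, d} = CARD('n)"
      using that card by simp
    then have UNIV: "UNIV = {a, b, c, d}"
      by (metis card_subset_eq finite subset_UNIV)
    have e: "s [p, a] * x $ a + s [p, b] * x $ b + s [p, c] * x $ c + s [p, d] * x $ d = 0" for p
      using row[of p] that unfolding UNIV by (simp add: add.assoc)
    have rows: "s [a, d] * x $ d = - (s [a, b] * x $ b + s [a, c] * x $ c)"
         "s [b, d] * x $ d = s [a, b] * x $ a - s [b, c] * x $ c"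
         "s [c, d] * x $ d = s [a, c] * x $ a + s [b, c] * x $ b"
      using e[of a] e[of b] e[of c] skew[of b a] skew[of c a] skew[of c b]
      by (simp_all add: eq_neg_iff_add_eq_0 algebra_simps)
    have "P a b c d * x $ d = s [a, b] * (s [c, d] * x $ d)
        - s [a, c] * (s [b, d] * x $ d) + s [b, c] * (s [a, d] * x $ d)"
      by (simp add: P_def algebra_simps)
    then show ?thesis
      unfolding rows by (simp add: algebra_simps)
  qed
  have "P i j k l = 0"
  proof (cases "distinct [i, j, k, l]")
    case True
    then have "card {i, j, k, l} = CARD('n)"
      using card by simp
    then have UNIV: "UNIV = {i, j, k, l}"
      by (metis card_subset_eq finite subset_UNIV)
    obtain m where m: "x $ m \<noteq> 0"
      using x(1) by (auto simp: vec_eq_iff)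
    have swap: "P i j k l = - P i j l k" "P i j k l = - P i l k j" "P i j k l = - P l j k i"
      unfolding P_def
      using skew[of j i] skew[of k i] skew[of l i] skew[of k j] skew[of l j] skew[of l k]
      by (simp_all add: algebra_simps)
    have "m \<in> {i, j, k, l}"
      using UNIV by blast
    then have "P i j k l * x $ m = 0"
      using P_last[of i j k l] P_last[of i j l k] P_last[of i l k j] P_last[of l j k i] True swap
      by auto
    with m show ?thesis by simp
  next
    case False
    then have "i = j \<or> i = k \<or> i = l \<or> j = k \<or> j = l \<or> k = l" by auto
    then show ?thesis
      unfolding P_def
      using skew[of j i] skew[of k i] skew[of l i] skew[of k j] skew[of l j] skew[of l k]
      by (auto simp: algebra_simps)
  qed
  then show ?thesis by (simp add: P_def)
qed

section \<open>Decomposable forms\<close>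

text \<open>
  The vectors are rows \<open>i\<close> and \<open>j\<close> of \<open>s\<close>, for some \<open>[i, j]\<close> with nonzero component \<open>c\<close>.  By the
  Pluecker relations their wedge is \<open>c s\<close>, so one row is divided by \<open>c\<close>.
\<close>

lemma pluecker_relations_imp_decomposable:
  fixes s :: "'n::finite tensor"
  assumes s: "s \<in> ext_power 2" "s \<noteq> 0"
    and rel: "\<And>i j k l. s [i, j] * s [k, l] - s [i, k] * s [j, l] + s [i, l] * s [j, k] = 0"
  obtains v w where "v \<noteq> w" "vec.independent {v, w}" "s = wedge (vec_tensor v) (vec_tensor w)"
proof -
  note skew = ext_power_2_skew[OF s(1)]
  have diag: "s [a, a] = 0" for a
    using skew[of a a] by simp
  obtain i j where c: "s [i, j] \<noteq> 0"
    using ext_power_2_eqI[OF s(1), of 0] s(2) by auto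
  define v :: "complex ^ 'n" where "v = (\<chi> k. s [i, k] / s [i, j])"
  define w :: "complex ^ 'n" where "w = (\<chi> k. s [j, k])"
  (* On the coordinates i and j the two rows are (0, 1) and (- s [i, j], 0). *)
  have at: "v $ j = 1" "w $ j = 0" "w $ i \<noteq> 0"
    using c skew[of j i] by (auto simp: v_def w_def diag)
  have "w \<noteq> 0"
    using at(3) by auto
  moreover have "v \<notin> vec.span {w}"
    using at by (auto simp: vec.span_singleton)
  ultimately have "vec.independent {v, w}" "v \<noteq> w"
    using at by (auto simp: vec.independent_insert)
  moreover have "s = wedge (vec_tensor v) (vec_tensor w)"
  proof (rule ext_power_2_eqI[OF s(1) wedge_vec_tensor_eq_0])
    fix k l
    have "s [i, j] * s [k, l] = s [i, k] * s [j, l] - s [i, l] * s [j, k]"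
      using rel[of i j k l] by (simp add: algebra_simps)
    then show "s [k, l] = wedge (vec_tensor v) (vec_tensor w) [k, l]"
      using c by (simp add: wedge_vec_tensor_pair v_def w_def field_simps)
  qed
  ultimately show thesis
    using that by blast
qed

lemma decomposable_in_Gr2_pluecker:
  fixes v w :: "complex ^ 'n::finite"
  assumes "v \<noteq> w" "vec.independent {v, w}"
  shows "tensor.span {wedge (vec_tensor v) (vec_tensor w)} \<in> Gr2_pluecker"
proof -
  have "vec.dim (vec.span {v, w}) = 2"
    using assms by (simp add: vec.dim_span_eq_card_independent del: vec.dim_span)
  then have "vec.span {v, w} \<in> Gr2"
    unfolding Gr2_def using vec.subspace_span by blast
  with assms show ?thesis
    unfolding Gr2_pluecker_def pluecker_def by blast
qed

lemma span_singleton_in_proj_space: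
  assumes "tensor.subspace Z" "s \<in> Z" "s \<noteq> 0"
  shows "tensor.span {s} \<in> proj_space Z"
proof -
  have "tensor.independent {s}"
    using assms(3) by simp
  then have "tensor.dim (tensor.span {s}) = 1"
    using tensor.dim_span_eq_card_independent[of "{s}"] by simp
  moreover have "tensor.span {s} \<subseteq> Z"
    using assms by (intro tensor.span_minimal) auto
  ultimately show ?thesis
    unfolding proj_space_def using tensor.subspace_span by blast
qed

theorem theorem3p6:
  fixes Z :: "4 tensor set"
  assumes "tensor.subspace Z"
    and "Z \<subseteq> ext_power 2"
    and "Z \<noteq> {0}"
    and "proj_space Z \<inter> Gr2_pluecker = {}"
  shows "self_adjoint 2 Z"
proof -
  obtain s where s: "s \<in> Z" "s \<noteq> 0"
    using tensor.subspace_0[OF assms(1)] assms(3) by blast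
  have ext: "s \<in> ext_power 2"
    using s(1) assms(2) by blast
  have "tensor_rank2 s = CARD(4)"
  proof (rule ccontr)
    assume "tensor_rank2 s \<noteq> CARD(4)"
    then have "s [i, j] * s [k, l] - s [i, k] * s [j, l] + s [i, l] * s [j, k] = 0" for i j k l
      using ext by (intro degenerate_imp_pluecker_relation) auto
    then obtain v w where "v \<noteq> w" "vec.independent {v, w}"
      "s = wedge (vec_tensor v) (vec_tensor w)"
      using pluecker_relations_imp_decomposable[OF ext s(2)] by blast
    then have "tensor.span {s} \<in> Gr2_pluecker"
      using decomposable_in_Gr2_pluecker by blast
    with span_singleton_in_proj_space[OF assms(1) s] assms(4) show False
      by blast
  qed
  moreover have "wedge (tscale c s) t \<in> Z" if "t \<in> ext_power (2 - 2)" for c t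
    using that s(1) assms(1) by (simp add: wedge_ext_power_0 tensor.subspace_scale)
  ultimately show ?thesis
    unfolding self_adjoint_def using ext by blast
qed

end
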